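(* Let $\Omega=\{h\in\mathbb{R}^I : A_\Omega^\top h+B_\Omega^\top\eta=b_\Omega \text{ for some } \eta\ge 0\}$ with $b_\Omega\in\mathbb{R}^k$ be a polytope (in particular compact), where $\eta\ge 0$ denotes potential nonnegative slack variables in the rows. Let $\beta^-,\beta^+\in\mathbb{R}^J$ be a lower and an upper bound for $\beta$, and $h^-,h^+\in\mathbb{R}^I$ a lower and an upper bound for $h$, in the sense of the Boundedness Assumption of the context. Then the optimal value of the following mixed-integer program is an upper bound on the optimal value of the trilevel mixed-integer problem $$\min_{x\in\mathcal{X}} G(x)+\max_{h\in\Omega}\ \min_{y\in\mathcal{Y}(x,h)}c^\top y:$$ $$\begin{aligned} \min\ & G(x)+(\beta^+)^\top u_\beta^+ +(\beta^-)^\top u_\beta^- + b_\Omega^\top u_\Omega + c^\top y\\ &-\sum_{i\in I,j\in J}\left(h_i^-\beta_j^-u^1_{ij}+h_i^+\beta_j^+u^2_{ij}+h_i^+\beta_j^-u^3_{ij}+h_i^-\beta_j^+u^4_{ij}\right)\\ \text{s.t. } & A'y\ge b',\\ & (By)_j+(u_\beta^+)_j+(u_\beta^-)_j-\sum_{i\in I}\left(h_i^-u^1_{ij}+h_i^+u^2_{ij}+h_i^+u^3_{ij}+h_i^-u^4_{ij}\right)\ge (B_xx+b_0)_j && \forall j\in J,\\ & u_\beta^+\ge 0,\quad -u_\beta^-\ge 0,\\ & (A_\Omega u_\Omega)_i-\sum_{j\in J}\left(\beta_j^-u^1_{ij}+\beta_j^+u^2_{ij}+\beta_j^-u^3_{ij}+\beta_j^+u^4_{ij}\right)\ge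 0 && \forall i\in I,\\ & B_\Omega u_\Omega\ge 0,\\ & u^1_{ij}+u^2_{ij}+u^3_{ij}+u^4_{ij}\ge (B_h)_{ij} && \forall i\in I,\ j\in J,\\ & -u^1_{ij}\ge 0,\quad -u^2_{ij}\ge 0,\quad u^3_{ij}\ge 0,\quad u^4_{ij}\ge 0 && \forall i\in I,\ j\in J,\\ & x\in\mathcal{X},\ u_\beta^+,u_\beta^-\in\mathbb{R}^J,\ u_\Omega\in\mathbb{R}^k,\ u^1,u^2,u^3,u^4\in\mathbb{R}^{I\times J},\ y\in\mathbb{R}^{n+l},\\ & y_{n+1},\dots,y_{n+l}\in\{0,1\}. \end{aligned}$$
   Context: Setting (weakly connected adjustable robust problem). $\mathcal{X}$ is a polytope of first-level decisions, $G$ is a real-valued first-level cost function on $\mathcal{X}$, $\Omega\subseteq\mathbb{R}^I$ is the polytope of uncertainties $h$ ($I$ a finite index set), and $c\in\mathbb{R}^{n+l}$. The third-level feasible set is $$\mathcal{Y}(x,h)=\{y\in\mathbb{R}^n\times\{0,1\}^l:\ A'y\ge b',\ By\ge B_xx+B_hh+b_0\},$$ i.e. $x$ and $h$ affect only the right-hand side of the constraints. $J$ is the finite index set of the rows of $By\ge B_xx+B_hh+b_0$. The symbol $(B_h)_{ij}$, $i\in I$, $j\in J$, denotes the coefficient of $h_i$ in the $j$-th component of $B_hh$, so that $(B_hh)^\top\beta=\sum_{i\in I,j\in J}(B_h)_{ij}h_i\beta_j$. For each $y'\in\{0,1\}^l$ let $A_fy\ge b_f$ be a system of linear inequalities (depending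 on $y'$) expressing $(y_{n+1},\dots,y_{n+l})^\top=y'$, and put $A^\top=((A')^\top,A_f^\top)$, $b^\top=((b')^\top,b_f^\top)$. The third-level LP for this fixing is $\min\{c^\top y: Ay\ge b,\ By\ge B_xx+B_hh+b_0\}$ and its dual is $$\max\{b^\top\alpha+(B_xx+B_hh+b_0)^\top\beta:\ A^\top\alpha+B^\top\beta=c,\ \alpha,\beta\ge 0\},$$ with $\beta\in\mathbb{R}^J$ the dual variables of $By\ge B_xx+B_hh+b_0$. Boundedness Assumption. There are $\beta^-\le\beta^+$ in $\mathbb{R}^J$ and $h^-\le h^+$ in $\mathbb{R}^I$ such that adding $h^-\le h\le h^+$ to $\Omega$ and $\beta^-\le\beta\le\beta^+$ to the dual program does not affect the outcome of the trilevel problem; that is, for every fixing $y'\in\{0,1\}^l$, $\min_{x\in\mathcal{X}}G(x)+\max_{h\in\Omega}\min\{c^\top y: Ay\ge b, By\ge B_xx+B_hh+b_0\}$ has the same optimal value as the problem obtained by replacing $\Omega$ by $\{h\in\Omega:h^-\le h\le h^+\}$ and the inner minimum by the dual program above with the additional constraint $\beta^-\le\beta\le\beta^+$. (Compactness of $\Omega$ already yields such $h^-,h^+$.)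
   Formalization: Added hypothesis: every h in Ω with h^- ≤ h ≤ h^+ is nonnegative; without it the claim fails for the printed program, e.g. Ω={-1}, third level min{y : y ≥ h}, 0 ≤ β ≤ 2, h^-=h^+=-1. *)

theory Defs
  imports "HOL-Analysis.Analysis"
begin

text \<open>
  Vectors are compared componentwise (the library order on \<^typ>\<open>real^'n\<close>), and optimal values are
  infima and suprema in \<^typ>\<open>ereal\<close>; in particular an infeasible minimisation has value \<open>\<infinity>\<close> and an
  infeasible maximisation has value \<open>-\<infinity>\<close>.

  The index type \<open>'v\<close> stands for the \<open>n + l\<close> third-level variables and \<open>L :: 'v set\<close> for the
  positions of the \<open>l\<close> binary ones, so that \<open>l = 0\<close> and \<open>n = 0\<close> are both included.
\<close>

definition uncertainty_set :: "real^'k^'i \<Rightarrow> real^'k^'s \<Rightarrow> real^'k \<Rightarrow> (real^'i) set" where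
  "uncertainty_set A\<Omega> B\<Omega> b\<Omega> =
     {h. \<exists>\<eta>. 0 \<le> \<eta> \<and> transpose A\<Omega> *v h + transpose B\<Omega> *v \<eta> = b\<Omega>}"

definition coupling_rhs ::
    "real^'m^'j \<Rightarrow> real^'i^'j \<Rightarrow> real^'j \<Rightarrow> real^'m \<Rightarrow> real^'i \<Rightarrow> real^'j" where
  "coupling_rhs Bx Bh b0 x h = Bx *v x + Bh *v h + b0"

definition third_level ::
    "'v set \<Rightarrow> real^'v^'r \<Rightarrow> real^'r \<Rightarrow> real^'v^'j \<Rightarrow> real^'m^'j \<Rightarrow> real^'i^'j \<Rightarrow> real^'j
     \<Rightarrow> real^'m \<Rightarrow> real^'i \<Rightarrow> (real^'v) set" where
  "third_level L A' b' B Bx Bh b0 x h =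
     {y. (\<forall>i\<in>L. y $ i \<in> {0, 1}) \<and> A' *v y \<ge> b' \<and> B *v y \<ge> coupling_rhs Bx Bh b0 x h}"

definition trilevel_value ::
    "(real^'m) set \<Rightarrow> (real^'m \<Rightarrow> real) \<Rightarrow> (real^'i) set \<Rightarrow> real^'v
     \<Rightarrow> (real^'m \<Rightarrow> real^'i \<Rightarrow> (real^'v) set) \<Rightarrow> ereal" where
  "trilevel_value X G \<Omega> c Y =
     (INF x\<in>X. ereal (G x) + (SUP h\<in>\<Omega>. INF y\<in>Y x h. ereal (c \<bullet> y)))"

text \<open>
  A fixing of the binary variables is a \<open>y' \<in> L \<rightarrow>\<^sub>E {0, 1}\<close>. The matrix \<open>A\<close> that stacks \<open>A'\<close> on top of
  \<open>A\<^sub>f\<close> is kept in two blocks; correspondingly \<open>\<alpha>\<close> is split into \<open>\<alpha>'\<close> and \<open>\<alpha>\<^sub>f\<close>.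
\<close>

definition expresses_fixing ::
    "'v set \<Rightarrow> (('v \<Rightarrow> real) \<Rightarrow> real^'v^'f) \<Rightarrow> (('v \<Rightarrow> real) \<Rightarrow> real^'f) \<Rightarrow> bool" where
  "expresses_fixing L Af bf \<longleftrightarrow>
     (\<forall>y'\<in>L \<rightarrow>\<^sub>E {0, 1}. \<forall>y. Af y' *v y \<ge> bf y' \<longleftrightarrow> (\<forall>i\<in>L. y $ i = y' i))"

definition fixed_primal ::
    "real^'v^'r \<Rightarrow> real^'r \<Rightarrow> real^'v^'f \<Rightarrow> real^'f \<Rightarrow> real^'v^'j \<Rightarrow> real^'m^'j \<Rightarrow> real^'i^'j
     \<Rightarrow> real^'j \<Rightarrow> real^'m \<Rightarrow> real^'i \<Rightarrow> (real^'v) set" where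
  "fixed_primal A' b' Af bf B Bx Bh b0 x h =
     {y. A' *v y \<ge> b' \<and> Af *v y \<ge> bf \<and> B *v y \<ge> coupling_rhs Bx Bh b0 x h}"

definition bounded_dual ::
    "real^'v^'r \<Rightarrow> real^'v^'f \<Rightarrow> real^'v^'j \<Rightarrow> real^'v \<Rightarrow> real^'j \<Rightarrow> real^'j
     \<Rightarrow> ((real^'r) \<times> (real^'f) \<times> (real^'j)) set" where
  "bounded_dual A' Af B c \<beta>m \<beta>p =
     {(\<alpha>', \<alpha>f, \<beta>).
        transpose A' *v \<alpha>' + transpose Af *v \<alpha>f + transpose B *v \<beta> = c \<and>
        0 \<le> \<alpha>' \<and> 0 \<le> \<alpha>f \<and> 0 \<le> \<beta> \<and> \<beta>m \<le> \<beta> \<and> \<beta> \<le> \<beta>p}"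

definition bounded_dual_value ::
    "(real^'m) set \<Rightarrow> (real^'m \<Rightarrow> real) \<Rightarrow> (real^'i) set \<Rightarrow> real^'v
     \<Rightarrow> real^'v^'r \<Rightarrow> real^'r \<Rightarrow> real^'v^'f \<Rightarrow> real^'f
     \<Rightarrow> real^'v^'j \<Rightarrow> real^'m^'j \<Rightarrow> real^'i^'j \<Rightarrow> real^'j
     \<Rightarrow> real^'j \<Rightarrow> real^'j \<Rightarrow> ereal" where
  "bounded_dual_value X G \<Omega> c A' b' Af bf B Bx Bh b0 \<beta>m \<beta>p =
     (INF x\<in>X. ereal (G x) +
        (SUP h\<in>\<Omega>. SUP (\<alpha>', \<alpha>f, \<beta>)\<in>bounded_dual A' Af B c \<beta>m \<beta>p.
           ereal (b' \<bullet> \<alpha>' + bf \<bullet> \<alpha>f + coupling_rhs Bx Bh b0 x h \<bullet> \<beta>)))"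

definition boundedness_assumption ::
    "(real^'m) set \<Rightarrow> (real^'m \<Rightarrow> real) \<Rightarrow> (real^'i) set \<Rightarrow> 'v set \<Rightarrow> real^'v
     \<Rightarrow> real^'v^'r \<Rightarrow> real^'r \<Rightarrow> (('v \<Rightarrow> real) \<Rightarrow> real^'v^'f) \<Rightarrow> (('v \<Rightarrow> real) \<Rightarrow> real^'f)
     \<Rightarrow> real^'v^'j \<Rightarrow> real^'m^'j \<Rightarrow> real^'i^'j \<Rightarrow> real^'j
     \<Rightarrow> real^'j \<Rightarrow> real^'j \<Rightarrow> real^'i \<Rightarrow> real^'i \<Rightarrow> bool" where
  "boundedness_assumption X G \<Omega> L c A' b' Af bf B Bx Bh b0 \<beta>m \<beta>p hm hp \<longleftrightarrow>
     \<beta>m \<le> \<beta>p \<and> hm \<le> hp \<and>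
     (\<forall>y'\<in>L \<rightarrow>\<^sub>E {0, 1}.
        trilevel_value X G \<Omega> c (fixed_primal A' b' (Af y') (bf y') B Bx Bh b0) =
        bounded_dual_value X G {h\<in>\<Omega>. hm \<le> h \<and> h \<le> hp} c A' b' (Af y') (bf y') B Bx Bh b0 \<beta>m \<beta>p)"

text \<open>
  The matrices \<open>u\<^sup>1, \<dots>, u\<^sup>4\<close> are indexed as \<open>u $ i $ j\<close> with \<open>i \<in> I\<close>, \<open>j \<in> J\<close>, whereas the coefficient
  \<open>(B\<^sub>h)\<^sub>i\<^sub>j\<close> of \<open>h\<^sub>i\<close> in row \<open>j\<close> is the matrix entry \<open>Bh $ j $ i\<close>.

  The inequality rows for \<open>A\<Omega> *v u\<Omega>\<close> and for \<open>u\<^sup>1 + u\<^sup>2 + u\<^sup>3 + u\<^sup>4\<close> are the dual rows of the variables \<open>h\<^sub>i\<close>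
  and \<open>w\<^sub>i\<^sub>j = h\<^sub>i \<beta>\<^sub>j\<close> when these are nonnegative (for variables of free sign they would be equations).
  Bounding the trilevel value by this program therefore needs \<open>h \<ge> 0\<close> on the uncertainties considered.
\<close>

definition mip_feasible ::
    "(real^'m) set \<Rightarrow> 'v set \<Rightarrow> real^'v^'r \<Rightarrow> real^'r
     \<Rightarrow> real^'v^'j \<Rightarrow> real^'m^'j \<Rightarrow> real^'i^'j \<Rightarrow> real^'j
     \<Rightarrow> real^'k^'i \<Rightarrow> real^'k^'s \<Rightarrow> real^'j \<Rightarrow> real^'j \<Rightarrow> real^'i \<Rightarrow> real^'i
     \<Rightarrow> real^'m \<Rightarrow> real^'j \<Rightarrow> real^'j \<Rightarrow> real^'k
     \<Rightarrow> real^'j^'i \<Rightarrow> real^'j^'i \<Rightarrow> real^'j^'i \<Rightarrow> real^'j^'i \<Rightarrow> real^'v \<Rightarrow> bool" where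
  "mip_feasible X L A' b' B Bx Bh b0 A\<Omega> B\<Omega> \<beta>m \<beta>p hm hp x up um u\<Omega> u1 u2 u3 u4 y \<longleftrightarrow>
     x \<in> X \<and> (\<forall>i\<in>L. y $ i \<in> {0, 1}) \<and>
     A' *v y \<ge> b' \<and>
     (\<forall>j. (B *v y) $ j + up $ j + um $ j
          - (\<Sum>i\<in>UNIV. hm $ i * u1 $ i $ j + hp $ i * u2 $ i $ j
                       + hp $ i * u3 $ i $ j + hm $ i * u4 $ i $ j)
          \<ge> (Bx *v x + b0) $ j) \<and>
     up \<ge> 0 \<and> - um \<ge> 0 \<and>
     (\<forall>i. (A\<Omega> *v u\<Omega>) $ i
          - (\<Sum>j\<in>UNIV. \<beta>m $ j * u1 $ i $ j + \<beta>p $ j * u2 $ i $ j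
                       + \<beta>m $ j * u3 $ i $ j + \<beta>p $ j * u4 $ i $ j)
          \<ge> 0) \<and>
     B\<Omega> *v u\<Omega> \<ge> 0 \<and>
     (\<forall>i j. u1 $ i $ j + u2 $ i $ j + u3 $ i $ j + u4 $ i $ j \<ge> Bh $ j $ i) \<and>
     (\<forall>i j. - u1 $ i $ j \<ge> 0 \<and> - u2 $ i $ j \<ge> 0 \<and> u3 $ i $ j \<ge> 0 \<and> u4 $ i $ j \<ge> 0)"

definition mip_objective ::
    "(real^'m \<Rightarrow> real) \<Rightarrow> real^'v \<Rightarrow> real^'k
     \<Rightarrow> real^'j \<Rightarrow> real^'j \<Rightarrow> real^'i \<Rightarrow> real^'i
     \<Rightarrow> real^'m \<Rightarrow> real^'j \<Rightarrow> real^'j \<Rightarrow> real^'k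
     \<Rightarrow> real^'j^'i \<Rightarrow> real^'j^'i \<Rightarrow> real^'j^'i \<Rightarrow> real^'j^'i \<Rightarrow> real^'v \<Rightarrow> real" where
  "mip_objective G c b\<Omega> \<beta>m \<beta>p hm hp x up um u\<Omega> u1 u2 u3 u4 y =
     G x + \<beta>p \<bullet> up + \<beta>m \<bullet> um + b\<Omega> \<bullet> u\<Omega> + c \<bullet> y
     - (\<Sum>i\<in>UNIV. \<Sum>j\<in>UNIV.
          hm $ i * \<beta>m $ j * u1 $ i $ j + hp $ i * \<beta>p $ j * u2 $ i $ j
        + hp $ i * \<beta>m $ j * u3 $ i $ j + hm $ i * \<beta>p $ j * u4 $ i $ j)"

definition mip_value ::
    "(real^'m) set \<Rightarrow> (real^'m \<Rightarrow> real) \<Rightarrow> 'v set \<Rightarrow> real^'v \<Rightarrow> real^'v^'r \<Rightarrow> real^'r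
     \<Rightarrow> real^'v^'j \<Rightarrow> real^'m^'j \<Rightarrow> real^'i^'j \<Rightarrow> real^'j
     \<Rightarrow> real^'k^'i \<Rightarrow> real^'k^'s \<Rightarrow> real^'k
     \<Rightarrow> real^'j \<Rightarrow> real^'j \<Rightarrow> real^'i \<Rightarrow> real^'i \<Rightarrow> ereal" where
  "mip_value X G L c A' b' B Bx Bh b0 A\<Omega> B\<Omega> b\<Omega> \<beta>m \<beta>p hm hp =
     Inf {ereal (mip_objective G c b\<Omega> \<beta>m \<beta>p hm hp x up um u\<Omega> u1 u2 u3 u4 y)
          | x up um u\<Omega> u1 u2 u3 u4 y.
            mip_feasible X L A' b' B Bx Bh b0 A\<Omega> B\<Omega> \<beta>m \<beta>p hm hp x up um u\<Omega> u1 u2 u3 u4 y}"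

end

theory Submission
  imports Defs
begin

text \<open>
  Fix a feasible point \<open>(x, u, y)\<close> of the mixed-integer program and let \<open>y'\<close> be its binary part. If the
  third-level player is forced to play \<open>y'\<close>, the trilevel value can only grow, and by the
  boundedness assumption it then equals the value in which the inner minimum has become a bounded
  dual maximum. The decision \<open>x\<close> is one candidate for the outer minimum, so it remains to see that
  the objective of the program bounds \<open>G x\<close> plus the dual objective at every scenario \<open>h\<close> in the box and every
  bounded dual solution \<open>(\<alpha>', \<alpha>\<^sub>f, \<beta>)\<close>; this is \<open>dual_objective_le_mip_objective\<close>.

  That estimate is a weak duality argument for the McCormick relaxation. In the dual objective only
  \<open>(B\<^sub>h h) \<bullet> \<beta> = (\<Sum>i j. (B\<^sub>h)\<^sub>i\<^sub>j h\<^sub>i \<beta>\<^sub>j)\<close> is nonlinear. Replacing each product \<open>h\<^sub>i \<beta>\<^sub>j\<close> by a variable \<open>w\<^sub>i\<^sub>j\<close>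
  with the four McCormick inequalities over the box \<open>[h\<^sup>-, h\<^sup>+] \<times> [\<beta>\<^sup>-, \<beta>\<^sup>+]\<close> gives a linear
  maximisation with at least the same value, and the program carries the constraints of its dual, with
  \<open>u\<^sup>1, \<dots>, u\<^sup>4\<close> the multipliers of the McCormick inequalities, \<open>u\<^sub>\<beta>\<^sup>\<plusminus>\<close> those of the bounds on \<open>\<beta>\<close>,
  \<open>u\<^sub>\<Omega>\<close> those of the description of \<open>\<Omega>\<close>, and \<open>y\<close> those of the dual equations. The relaxation
  need not be formed: multiplying each row of the program by the corresponding value of \<open>h\<^sub>i\<close>,
  \<open>\<beta>\<^sub>j\<close> or \<open>h\<^sub>i \<beta>\<^sub>j\<close> and adding up yields the estimate. Rows are inequalities, so these multipliers
  have to be nonnegative, which is where \<open>h \<ge> 0\<close> enters.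
\<close>

lemma inner_left_mono_vec:
  fixes a u v :: "real^'n"
  assumes "0 \<le> a" and "u \<le> v"
  shows "a \<bullet> u \<le> a \<bullet> v"
  using assms by (auto simp: inner_vec_def less_eq_vec_def intro!: sum_mono mult_left_mono)

text \<open>
  Weak duality of the third-level LP, without its coupling constraints: their right-hand side
  depends on the scenario, so they are kept apart as the term \<open>\<beta> \<bullet> (B *v y)\<close>.
\<close>

lemma partial_weak_duality:
  fixes A' :: "real^'v^'r" and Af :: "real^'v^'f" and B :: "real^'v^'j"
  assumes "(\<alpha>', \<alpha>f, \<beta>) \<in> bounded_dual A' Af B c \<beta>m \<beta>p"
    and "A' *v y \<ge> b'" and "Af *v y \<ge> bf"
  shows "b' \<bullet> \<alpha>' + bf \<bullet> \<alpha>f + \<beta> \<bullet> (B *v y) \<le> c \<bullet> y"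
proof -
  have eq: "transpose A' *v \<alpha>' + transpose Af *v \<alpha>f + transpose B *v \<beta> = c"
    and nn: "0 \<le> \<alpha>'" "0 \<le> \<alpha>f"
    using assms(1) by (auto simp: bounded_dual_def)
  have "c \<bullet> y = \<alpha>' \<bullet> (A' *v y) + \<alpha>f \<bullet> (Af *v y) + \<beta> \<bullet> (B *v y)"
    unfolding eq[symmetric] by (simp add: inner_add_left dot_lmul_matrix)
  with inner_left_mono_vec[OF nn(1) assms(2)] inner_left_mono_vec[OF nn(2) assms(3)]
  show ?thesis by (simp add: inner_commute)
qed

text \<open>
  The four McCormick inequalities for the product \<open>h \<beta>\<close>, combined with their multipliers. The left
  side minus the right side is
  \<open>(h - hm) (\<beta> - \<beta>m) u1 + (h - hp) (\<beta> - \<beta>p) u2 + (h - hp) (\<beta> - \<beta>m) u3 + (h - hm) (\<beta> - \<beta>p) u4\<close>,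
  and each summand is nonpositive on the box.
\<close>

lemma mccormick_combination:
  fixes h \<beta> hm hp \<beta>m \<beta>p u1 u2 u3 u4 :: real
  assumes "hm \<le> h" "h \<le> hp" "\<beta>m \<le> \<beta>" "\<beta> \<le> \<beta>p" "u1 \<le> 0" "u2 \<le> 0" "0 \<le> u3" "0 \<le> u4"
  shows "h * \<beta> * (u1 + u2 + u3 + u4)
           + (hm * \<beta>m * u1 + hp * \<beta>p * u2 + hp * \<beta>m * u3 + hm * \<beta>p * u4)
         \<le> \<beta> * (hm * u1 + hp * u2 + hp * u3 + hm * u4)
           + h * (\<beta>m * u1 + \<beta>p * u2 + \<beta>m * u3 + \<beta>p * u4)"
proof -
  have "(h - hm) * (\<beta> - \<beta>m) * u1 \<le> 0" "(h - hp) * (\<beta> - \<beta>p) * u2 \<le> 0"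
    "(h - hp) * (\<beta> - \<beta>m) * u3 \<le> 0" "(h - hm) * (\<beta> - \<beta>p) * u4 \<le> 0"
    using assms by (auto simp: mult_le_0_iff zero_le_mult_iff)
  then show ?thesis by (simp add: algebra_simps)
qed

text \<open>
  Scalar products of \<open>h\<close> with the rows of the uncertainty description: the slack \<open>\<eta>\<close> contributes
  nonnegatively because \<open>B\<^sub>\<Omega> u\<^sub>\<Omega> \<ge> 0\<close>.
\<close>

lemma uncertainty_set_inner_le:
  fixes A\<Omega> :: "real^'k^'i" and B\<Omega> :: "real^'k^'s"
  assumes "h \<in> uncertainty_set A\<Omega> B\<Omega> b\<Omega>" and "B\<Omega> *v u\<Omega> \<ge> 0"
  shows "h \<bullet> (A\<Omega> *v u\<Omega>) \<le> b\<Omega> \<bullet> u\<Omega>"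
proof -
  obtain \<eta> where \<eta>: "0 \<le> \<eta>" and eq: "transpose A\<Omega> *v h + transpose B\<Omega> *v \<eta> = b\<Omega>"
    using assms(1) by (auto simp: uncertainty_set_def)
  have "b\<Omega> \<bullet> u\<Omega> = h \<bullet> (A\<Omega> *v u\<Omega>) + \<eta> \<bullet> (B\<Omega> *v u\<Omega>)"
    unfolding eq[symmetric] by (simp add: inner_add_left dot_lmul_matrix)
  with inner_left_mono_vec[OF \<eta> assms(2)] show ?thesis by simp
qed

text \<open>
  The core estimate. The rows of the program for \<open>\<beta>\<^sub>j\<close>, \<open>h\<^sub>i\<close> and \<open>w\<^sub>i\<^sub>j\<close> are weighted with \<open>\<beta>\<^sub>j\<close>, \<open>h\<^sub>i\<close> and
  \<open>h\<^sub>i \<beta>\<^sub>j\<close>; what is left over between them is a sum over \<open>i, j\<close> of McCormick combinations.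
\<close>

lemma dual_objective_le_mip_objective:
  fixes A' :: "real^'v::finite^'r" and Af :: "real^'v^'f" and B :: "real^'v^'j"
    and Bx :: "real^'m^'j" and Bh :: "real^'i^'j" and A\<Omega> :: "real^'k^'i" and B\<Omega> :: "real^'k^'s"
  assumes feas: "mip_feasible X L A' b' B Bx Bh b0 A\<Omega> B\<Omega> \<beta>m \<beta>p hm hp x up um u\<Omega> u1 u2 u3 u4 y"
    and fix_y: "Af *v y \<ge> bf"
    and h: "h \<in> uncertainty_set A\<Omega> B\<Omega> b\<Omega>" "hm \<le> h" "h \<le> hp" "0 \<le> h"
    and dual: "(\<alpha>', \<alpha>f, \<beta>) \<in> bounded_dual A' Af B c \<beta>m \<beta>p"
  shows "G x + (b' \<bullet> \<alpha>' + bf \<bullet> \<alpha>f + coupling_rhs Bx Bh b0 x h \<bullet> \<beta>)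
         \<le> mip_objective G c b\<Omega> \<beta>m \<beta>p hm hp x up um u\<Omega> u1 u2 u3 u4 y"
proof -
  define P where "P i j = hm $ i * u1 $ i $ j + hp $ i * u2 $ i $ j
                        + hp $ i * u3 $ i $ j + hm $ i * u4 $ i $ j" for i j
  define Q where "Q i j = \<beta>m $ j * u1 $ i $ j + \<beta>p $ j * u2 $ i $ j
                        + \<beta>m $ j * u3 $ i $ j + \<beta>p $ j * u4 $ i $ j" for i j
  define R where "R i j = hm $ i * \<beta>m $ j * u1 $ i $ j + hp $ i * \<beta>p $ j * u2 $ i $ j
                        + hp $ i * \<beta>m $ j * u3 $ i $ j + hm $ i * \<beta>p $ j * u4 $ i $ j" for i j
  have \<beta>: "0 \<le> \<beta>" "\<beta>m \<le> \<beta>" "\<beta> \<le> \<beta>p"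
    using dual by (auto simp: bounded_dual_def)
  have Ay: "A' *v y \<ge> b'" and up: "0 \<le> up" and um: "0 \<le> - um" and Bu: "B\<Omega> *v u\<Omega> \<ge> 0"
    and row_\<beta>: "\<And>j. (Bx *v x + b0) $ j \<le> (B *v y) $ j + up $ j + um $ j - (\<Sum>i\<in>UNIV. P i j)"
    and row_h: "\<And>i. (\<Sum>j\<in>UNIV. Q i j) \<le> (A\<Omega> *v u\<Omega>) $ i"
    and row_w: "\<And>i j. Bh $ j $ i \<le> u1 $ i $ j + u2 $ i $ j + u3 $ i $ j + u4 $ i $ j"
    and sgn: "\<And>i j. u1 $ i $ j \<le> 0" "\<And>i j. u2 $ i $ j \<le> 0"
             "\<And>i j. 0 \<le> u3 $ i $ j" "\<And>i j. 0 \<le> u4 $ i $ j"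
    using feas by (auto simp: mip_feasible_def P_def Q_def)

  have "Bx *v x + b0 \<le> B *v y + up + um - (\<chi> j. \<Sum>i\<in>UNIV. P i j)"
    using row_\<beta> by (simp add: less_eq_vec_def)
  from inner_left_mono_vec[OF \<beta>(1) this]
  have coupling: "\<beta> \<bullet> (Bx *v x + b0)
      \<le> \<beta> \<bullet> (B *v y) + \<beta> \<bullet> up + \<beta> \<bullet> um - (\<Sum>i\<in>UNIV. \<Sum>j\<in>UNIV. \<beta> $ j * P i j)"
    by (subst sum.swap)
      (simp add: inner_add_right inner_diff_right inner_vec_def[of \<beta> "vec_lambda _"] sum_distrib_left)

  have bounds: "\<beta> \<bullet> up \<le> \<beta>p \<bullet> up" "\<beta> \<bullet> um \<le> \<beta>m \<bullet> um"
    using inner_left_mono_vec[OF up \<beta>(3)] inner_left_mono_vec[OF um \<beta>(2)]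
    by (simp_all add: inner_commute)

  have "(\<chi> i. \<Sum>j\<in>UNIV. Q i j) \<le> A\<Omega> *v u\<Omega>"
    using row_h by (simp add: less_eq_vec_def)
  from inner_left_mono_vec[OF h(4) this] uncertainty_set_inner_le[OF h(1) Bu]
  have uncertainty: "(\<Sum>i\<in>UNIV. \<Sum>j\<in>UNIV. h $ i * Q i j) \<le> b\<Omega> \<bullet> u\<Omega>"
    by (simp add: inner_vec_def[of h "vec_lambda _"] sum_distrib_left)

  have "(Bh *v h) \<bullet> \<beta> = (\<Sum>i\<in>UNIV. \<Sum>j\<in>UNIV. h $ i * \<beta> $ j * Bh $ j $ i)"
    by (subst sum.swap)
      (simp add: inner_vec_def matrix_vector_mult_def sum_distrib_right sum_distrib_left mult_ac)
  also have "\<dots> \<le> (\<Sum>i\<in>UNIV. \<Sum>j\<in>UNIV. \<beta> $ j * P i j + h $ i * Q i j - R i j)"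
  proof (intro sum_mono)
    fix i j
    have "h $ i * \<beta> $ j * Bh $ j $ i
        \<le> h $ i * \<beta> $ j * (u1 $ i $ j + u2 $ i $ j + u3 $ i $ j + u4 $ i $ j)"
      using h(4) \<beta>(1) by (intro mult_left_mono row_w mult_nonneg_nonneg) (auto simp: less_eq_vec_def)
    also have "\<dots> \<le> \<beta> $ j * P i j + h $ i * Q i j - R i j"
      using mccormick_combination[of "hm $ i" "h $ i" "hp $ i" "\<beta>m $ j" "\<beta> $ j" "\<beta>p $ j"
          "u1 $ i $ j" "u2 $ i $ j" "u3 $ i $ j" "u4 $ i $ j"] h(2,3) \<beta>(2,3) sgn
      by (simp add: less_eq_vec_def P_def Q_def R_def)
    finally show "h $ i * \<beta> $ j * Bh $ j $ i \<le> \<beta> $ j * P i j + h $ i * Q i j - R i j" .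
  qed
  finally have bilinear: "(Bh *v h) \<bullet> \<beta>
      \<le> (\<Sum>i\<in>UNIV. \<Sum>j\<in>UNIV. \<beta> $ j * P i j) + (\<Sum>i\<in>UNIV. \<Sum>j\<in>UNIV. h $ i * Q i j)
        - (\<Sum>i\<in>UNIV. \<Sum>j\<in>UNIV. R i j)"
    by (simp add: sum.distrib sum_subtractf)

  have "coupling_rhs Bx Bh b0 x h \<bullet> \<beta> = \<beta> \<bullet> (Bx *v x + b0) + (Bh *v h) \<bullet> \<beta>"
    by (simp add: coupling_rhs_def inner_add_left inner_add_right inner_commute)
  with partial_weak_duality[OF dual Ay fix_y] coupling bounds uncertainty bilinear
  show ?thesis
    unfolding mip_objective_def R_def[symmetric] by linarith
qed

text \<open>
  Forcing a binary part on the third-level player shrinks the feasible set of the innermost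
  minimum, so every such restriction bounds the trilevel value from above.
\<close>

lemma trilevel_value_antimono:
  assumes "\<And>x h. Y' x h \<subseteq> Y x h"
  shows "trilevel_value X G \<Omega> c Y \<le> trilevel_value X G \<Omega> c Y'"
  unfolding trilevel_value_def
  by (intro INF_mono' add_left_mono SUP_subset_mono INF_superset_mono order_refl assms)

theorem theorem2:
  fixes X :: "(real^'m) set" and G :: "real^'m \<Rightarrow> real"
    and L :: "'v::finite set" and c :: "real^'v"
    and A' :: "real^'v^'r" and b' :: "real^'r"
    and Af :: "('v \<Rightarrow> real) \<Rightarrow> real^'v^'f" and bf :: "('v \<Rightarrow> real) \<Rightarrow> real^'f"
    and B :: "real^'v^'j" and Bx :: "real^'m^'j" and Bh :: "real^'i^'j" and b0 :: "real^'j"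
    and A\<Omega> :: "real^'k^'i" and B\<Omega> :: "real^'k^'s" and b\<Omega> :: "real^'k"
    and \<Omega> :: "(real^'i) set"
    and \<beta>m \<beta>p :: "real^'j" and hm hp :: "real^'i"
  assumes "polytope X"
    and \<Omega>_def: "\<Omega> = uncertainty_set A\<Omega> B\<Omega> b\<Omega>" and "polytope \<Omega>"
    and h_nonneg: "\<And>h. h \<in> \<Omega> \<Longrightarrow> hm \<le> h \<Longrightarrow> h \<le> hp \<Longrightarrow> 0 \<le> h"
    and "expresses_fixing L Af bf"
    and "boundedness_assumption X G \<Omega> L c A' b' Af bf B Bx Bh b0 \<beta>m \<beta>p hm hp"
  shows "trilevel_value X G \<Omega> c (third_level L A' b' B Bx Bh b0)
         \<le> mip_value X G L c A' b' B Bx Bh b0 A\<Omega> B\<Omega> b\<Omega> \<beta>m \<beta>p hm hp"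
proof -
  have "trilevel_value X G \<Omega> c (third_level L A' b' B Bx Bh b0)
      \<le> ereal (mip_objective G c b\<Omega> \<beta>m \<beta>p hm hp x up um u\<Omega> u1 u2 u3 u4 y)"
    if feas: "mip_feasible X L A' b' B Bx Bh b0 A\<Omega> B\<Omega> \<beta>m \<beta>p hm hp x up um u\<Omega> u1 u2 u3 u4 y"
    for x up um u\<Omega> u1 u2 u3 u4 y
  proof -
    let ?obj = "mip_objective G c b\<Omega> \<beta>m \<beta>p hm hp x up um u\<Omega> u1 u2 u3 u4 y"
    let ?\<Omega> = "{h\<in>\<Omega>. hm \<le> h \<and> h \<le> hp}"
    define y' where "y' = restrict (($) y) L"
    have x: "x \<in> X" and y': "y' \<in> L \<rightarrow>\<^sub>E {0, 1}"
      using feas by (auto simp: mip_feasible_def y'_def)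
    have fixing: "Af y' *v z \<ge> bf y' \<longleftrightarrow> (\<forall>i\<in>L. z $ i = y' i)" for z
      using \<open>expresses_fixing L Af bf\<close> y' by (auto simp: expresses_fixing_def)
    have y: "Af y' *v y \<ge> bf y'"
      unfolding fixing by (simp add: y'_def)

    have "trilevel_value X G \<Omega> c (third_level L A' b' B Bx Bh b0)
        \<le> trilevel_value X G \<Omega> c (fixed_primal A' b' (Af y') (bf y') B Bx Bh b0)"
      using y' by (intro trilevel_value_antimono)
        (auto simp: fixed_primal_def third_level_def fixing PiE_def Pi_def)
    also have "\<dots> = bounded_dual_value X G ?\<Omega> c A' b' (Af y') (bf y') B Bx Bh b0 \<beta>m \<beta>p"
      using \<open>boundedness_assumption _ _ _ _ _ _ _ _ _ _ _ _ _ _ _ _ _\<close> y'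
      by (simp add: boundedness_assumption_def)
    also have "\<dots> \<le> ereal (G x) + (SUP h\<in>?\<Omega>. SUP (\<alpha>', \<alpha>f, \<beta>)\<in>bounded_dual A' (Af y') B c \<beta>m \<beta>p.
        ereal (b' \<bullet> \<alpha>' + bf y' \<bullet> \<alpha>f + coupling_rhs Bx Bh b0 x h \<bullet> \<beta>))"
      unfolding bounded_dual_value_def by (rule INF_lower[OF x])
    also have "\<dots> \<le> ereal (G x) + ereal (?obj - G x)"
    proof (intro add_left_mono SUP_least)
      fix h d
      assume h: "h \<in> ?\<Omega>" and d: "d \<in> bounded_dual A' (Af y') B c \<beta>m \<beta>p"
      obtain \<alpha>' \<alpha>f \<beta> where d_eq: "d = (\<alpha>', \<alpha>f, \<beta>)"
        by (cases d)
      have "G x + (b' \<bullet> \<alpha>' + bf y' \<bullet> \<alpha>f + coupling_rhs Bx Bh b0 x h \<bullet> \<beta>) \<le> ?obj"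
        using h d h_nonneg unfolding d_eq \<Omega>_def
        by (intro dual_objective_le_mip_objective[OF feas y]) auto
      then show "(case d of (\<alpha>', \<alpha>f, \<beta>) \<Rightarrow>
          ereal (b' \<bullet> \<alpha>' + bf y' \<bullet> \<alpha>f + coupling_rhs Bx Bh b0 x h \<bullet> \<beta>)) \<le> ereal (?obj - G x)"
        by (simp add: d_eq)
    qed
    finally show ?thesis by simp
  qed
  then show ?thesis
    unfolding mip_value_def by (auto intro!: Inf_greatest)
qed

end
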